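(* Every maximum circular split system on a finite set $X$ is orderly.
   Context: A distance on $X$ is a symmetric map $D:X\times X\to\mathbb{R}$ with $D(x,x)=0$, $D(x,y)\ge0$. A split of $X$ is a bipartition $\{A,B\}$ into two non-empty sets, written $A|B$; a split system on $X$ is a non-empty set of splits. For a split $S=A|B$, $D_S(x,y)=1$ if exactly one of $x,y$ lies in $A$ and $0$ otherwise; for a weighting $\omega:\mathcal{S}\to\mathbb{R}_{\ge0}$, $D_{(\mathcal{S},\omega)}=\sum_{S\in\mathcal{S}}\omega(S)D_S$. For a distance $D$ and $u\ne v$ let $X_{u,v}=\{x: D(u,x)<D(v,x)\}$, $E_{\{u,v\}}=\{x: D(u,x)=D(v,x)\}$, and for $q\ge\frac p2>0$ define the order distance $$O_{p,q}(D)=\sum_{\substack{(u,v),\ u\neq v\\ \emptyset\subsetneq X_{u,v}\subsetneq X}}\tfrac{p}{2} D_{X_{u,v}|X-X_{u,v}}+\sum_{\substack{\{u,v\},\ u\ne v\\ \emptyset\subsetneq E_{\{u,v\}}\subsetneq X}}\left(q-\tfrac p2\right)D_{E_{\{u,v\}}|X-E_{\{u,v\}}}.$$ A split system $\mathcal{S}$ is orderly if for all $p,q$ with $q=\frac p2>0$ and every non-negative weighting $\omega$ of $\mathcal{S}$ there is a non-negative weighting $\omega'$ of $\mathcal{S}$ with $O_{p,q}(D_{(\mathcal{S},\omega)})=D_{(\mathcal{S},\omega')}$. A split system is circular if there is an ordering $x_1,\dots,x_n$ of $X$ such that every split in it has the form $\{x_i,\dots,x_j\}|X-\{x_i,\dots,x_j\}$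 with $1\le i\le j<n$; it is maximum circular if it is circular and has the maximum possible size $\binom{n}{2}$, $n=|X|$. *)

theory Defs
  imports Complex_Main "HOL-Library.Disjoint_Sets"
begin

(* The ground set is an explicit carrier X :: 'a set.  A distance on X is a function
   'a \<Rightarrow> 'a \<Rightarrow> real of which only the values on X \<times> X matter; distances on X are therefore
   compared on X only.  A split A|B is the two-element set {A, B}, hence unordered. *)

definition is_split :: "'a set \<Rightarrow> 'a set set \<Rightarrow> bool" where
  "is_split X S \<longleftrightarrow> partition_on X S \<and> card S = 2"

definition split_system :: "'a set \<Rightarrow> 'a set set set \<Rightarrow> bool" where
  "split_system X \<S> \<longleftrightarrow> \<S> \<noteq> {} \<and> (\<forall>S\<in>\<S>. is_split X S)"

(* The split A | X - A. *)
definition split_of :: "'a set \<Rightarrow> 'a set \<Rightarrow> 'a set set" where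
  "split_of X A = {A, X - A}"

(* For S = {A, B} and x, y in X, exactly one of x, y lies in A iff exactly one lies in B,
   so the existential does not depend on the choice of a side. *)
definition split_dist :: "'a set set \<Rightarrow> 'a \<Rightarrow> 'a \<Rightarrow> real" where
  "split_dist S x y = (if \<exists>A\<in>S. (x \<in> A) \<noteq> (y \<in> A) then 1 else 0)"

definition weighted_dist :: "'a set set set \<Rightarrow> ('a set set \<Rightarrow> real) \<Rightarrow> 'a \<Rightarrow> 'a \<Rightarrow> real" where
  "weighted_dist \<S> \<omega> x y = (\<Sum>S\<in>\<S>. \<omega> S * split_dist S x y)"

definition closer_set :: "'a set \<Rightarrow> ('a \<Rightarrow> 'a \<Rightarrow> real) \<Rightarrow> 'a \<Rightarrow> 'a \<Rightarrow> 'a set" where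
  "closer_set X D u v = {x \<in> X. D u x < D v x}"

(* Takes the unordered pair P = {u, v}, so that it can be summed over without counting
   {u, v} twice. *)
definition equidistant_set :: "'a set \<Rightarrow> ('a \<Rightarrow> 'a \<Rightarrow> real) \<Rightarrow> 'a set \<Rightarrow> 'a set" where
  "equidistant_set X D P = {x \<in> X. \<forall>u\<in>P. \<forall>v\<in>P. D u x = D v x}"

definition order_dist ::
  "'a set \<Rightarrow> real \<Rightarrow> real \<Rightarrow> ('a \<Rightarrow> 'a \<Rightarrow> real) \<Rightarrow> 'a \<Rightarrow> 'a \<Rightarrow> real" where
  "order_dist X p q D x y =
     (\<Sum>(u, v) \<in> {(u, v). u \<in> X \<and> v \<in> X \<and> u \<noteq> v \<and>
                      {} \<subset> closer_set X D u v \<and> closer_set X D u v \<subset> X}.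
        p / 2 * split_dist (split_of X (closer_set X D u v)) x y) +
     (\<Sum>P \<in> {{u, v} | u v. u \<in> X \<and> v \<in> X \<and> u \<noteq> v \<and>
                      {} \<subset> equidistant_set X D {u, v} \<and> equidistant_set X D {u, v} \<subset> X}.
        (q - p / 2) * split_dist (split_of X (equidistant_set X D P)) x y)"

definition orderly :: "'a set \<Rightarrow> 'a set set set \<Rightarrow> bool" where
  "orderly X \<S> \<longleftrightarrow>
     split_system X \<S> \<and>
     (\<forall>p q. q = p / 2 \<and> p / 2 > 0 \<longrightarrow>
       (\<forall>\<omega>. (\<forall>S\<in>\<S>. \<omega> S \<ge> 0) \<longrightarrow>
         (\<exists>\<omega>'. (\<forall>S\<in>\<S>. \<omega>' S \<ge> 0) \<and>
           (\<forall>x\<in>X. \<forall>y\<in>X.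
              order_dist X p q (weighted_dist \<S> \<omega>) x y = weighted_dist \<S> \<omega>' x y))))"

definition circular :: "'a set \<Rightarrow> 'a set set set \<Rightarrow> bool" where
  "circular X \<S> \<longleftrightarrow>
     split_system X \<S> \<and>
     (\<exists>f :: nat \<Rightarrow> 'a. bij_betw f {1..card X} X \<and>
       (\<forall>S\<in>\<S>. \<exists>i j. 1 \<le> i \<and> i \<le> j \<and> j < card X \<and> S = split_of X (f ` {i..j})))"

definition maximum_circular :: "'a set \<Rightarrow> 'a set set set \<Rightarrow> bool" where
  "maximum_circular X \<S> \<longleftrightarrow> circular X \<S> \<and> card \<S> = card X choose 2"

end

theory Submission
  imports Defs
begin

text \<open>Writing \<open>g x = D v x - D u x\<close>, the Kalmanson inequalities for a distance \<open>D\<close> that is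
  circular with respect to a cyclic order say that \<open>g\<close> decreases along both arcs leading from
  \<open>u\<close> to \<open>v\<close>. Hence no four cyclically ordered points alternate between \<open>g > 0\<close> and
  \<open>g \<le> 0\<close>, so the set of points closer to \<open>u\<close> than to \<open>v\<close> is an arc. By counting, a maximum
  circular split system contains every arc split, so for \<open>q = p / 2\<close> the order distance is
  already a sum over splits of the system.\<close>

section \<open>Kalmanson inequalities for cyclically ordered positions\<close>

text \<open>The order is weak so that \<open>u\<close> and \<open>v\<close> may coincide with the
  points compared along the arcs between them.\<close>

definition cyclic4 :: "nat \<Rightarrow> nat \<Rightarrow> nat \<Rightarrow> nat \<Rightarrow> bool" where
  "cyclic4 a b c d \<longleftrightarrow>
     a \<le> b \<and> b \<le> c \<and> c \<le> d \<or> b \<le> c \<and> c \<le> d \<and> d \<le> a \<or>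
     c \<le> d \<and> d \<le> a \<and> a \<le> b \<or> d \<le> a \<and> a \<le> b \<and> b \<le> c"

text \<open>Rotating the four points gives both inequalities of the usual Kalmanson condition.\<close>

definition kalmanson_on :: "nat set \<Rightarrow> (nat \<Rightarrow> nat \<Rightarrow> real) \<Rightarrow> bool" where
  "kalmanson_on N d \<longleftrightarrow>
     (\<forall>x\<in>N. \<forall>y\<in>N. d x y = d y x) \<and>
     (\<forall>a\<in>N. \<forall>b\<in>N. \<forall>c\<in>N. \<forall>e\<in>N. cyclic4 a b c e \<longrightarrow> d a b + d c e \<le> d a c + d b e)"

text \<open>Both sides have the same parity, so the inequality could only fail as 2 against 0, with
  the interval separating \<open>a\<close>, \<open>c\<close> from \<open>b\<close>,
  \<open>e\<close>. Points in cyclic order never alternate like this.\<close>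

lemma kalmanson_on_interval:
  "kalmanson_on N (\<lambda>x y. if (x \<in> {i..j}) \<noteq> (y \<in> {i..j}) then 1 else 0)"
proof -
  have alt: "\<not> (a \<in> {i..j} \<and> c \<in> {i..j} \<and> b \<notin> {i..j} \<and> e \<notin> {i..j})"
    "\<not> (b \<in> {i..j} \<and> e \<in> {i..j} \<and> a \<notin> {i..j} \<and> c \<notin> {i..j})"
    if "cyclic4 a b c e" for a b c e
    using that unfolding cyclic4_def by (elim disjE; simp)+
  show ?thesis unfolding kalmanson_on_def
  proof (intro conjI ballI impI)
    fix a b c e assume "cyclic4 a b c e"
    from alt[OF this]
    show "(if (a \<in> {i..j}) \<noteq> (b \<in> {i..j}) then 1 else 0)
        + (if (c \<in> {i..j}) \<noteq> (e \<in> {i..j}) then 1 else 0)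
      \<le> (if (a \<in> {i..j}) \<noteq> (c \<in> {i..j}) then 1 else 0)
        + (if (b \<in> {i..j}) \<noteq> (e \<in> {i..j}) then 1 else (0::real))"
      by (auto simp del: atLeastAtMost_iff)
  qed (simp del: atLeastAtMost_iff)
qed

lemma kalmanson_on_cong:
  assumes "kalmanson_on N d" and "\<And>x y. x \<in> N \<Longrightarrow> y \<in> N \<Longrightarrow> d' x y = d x y"
  shows "kalmanson_on N d'"
  unfolding kalmanson_on_def
proof (intro conjI ballI impI)
  fix x y assume "x \<in> N" "y \<in> N"
  then show "d' x y = d' y x"
    using assms unfolding kalmanson_on_def by metis
next
  fix a b c e assume N: "a \<in> N" "b \<in> N" "c \<in> N" "e \<in> N" and cyc: "cyclic4 a b c e"
  have "d a b + d c e \<le> d a c + d b e"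
    using assms(1) N cyc unfolding kalmanson_on_def by blast
  then show "d' a b + d' c e \<le> d' a c + d' b e" using assms(2) N by metis
qed

lemma kalmanson_on_weighted_sum:
  assumes "\<And>S. S \<in> \<S> \<Longrightarrow> 0 \<le> w S" and K: "\<And>S. S \<in> \<S> \<Longrightarrow> kalmanson_on N (d S)"
  shows "kalmanson_on N (\<lambda>x y. \<Sum>S\<in>\<S>. w S * d S x y)"
  unfolding kalmanson_on_def
proof (intro conjI ballI impI)
  fix x y assume "x \<in> N" "y \<in> N"
  then show "(\<Sum>S\<in>\<S>. w S * d S x y) = (\<Sum>S\<in>\<S>. w S * d S y x)"
    using K unfolding kalmanson_on_def by (intro sum.cong) auto
next
  fix a b c e assume N: "a \<in> N" "b \<in> N" "c \<in> N" "e \<in> N" and cyc: "cyclic4 a b c e"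
  have "w S * d S a b + w S * d S c e \<le> w S * d S a c + w S * d S b e" if "S \<in> \<S>" for S
  proof -
    have "d S a b + d S c e \<le> d S a c + d S b e"
      using K[OF that] N cyc unfolding kalmanson_on_def by blast
    then have "w S * (d S a b + d S c e) \<le> w S * (d S a c + d S b e)"
      using assms(1)[OF that] by (rule mult_left_mono)
    then show ?thesis by (simp add: distrib_left)
  qed
  then show "(\<Sum>S\<in>\<S>. w S * d S a b) + (\<Sum>S\<in>\<S>. w S * d S c e)
      \<le> (\<Sum>S\<in>\<S>. w S * d S a c) + (\<Sum>S\<in>\<S>. w S * d S b e)"
    unfolding sum.distrib[symmetric] by (rule sum_mono)
qed

text \<open>The two cases are the two arcs from \<open>u\<close> to \<open>v\<close>, with
  \<open>x\<close> before \<open>y\<close>; each is a Kalmanson inequality rearranged.\<close>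

lemma kalmanson_difference_mono:
  assumes K: "kalmanson_on N d" and N: "u \<in> N" "v \<in> N" "x \<in> N" "y \<in> N"
    and cyc: "cyclic4 u x y v \<or> cyclic4 v y x u"
  shows "d v y - d u y \<le> d v x - d u x"
proof -
  have "d u x + d y v \<le> d u y + d x v \<or> d v y + d x u \<le> d v x + d y u"
    using K N cyc unfolding kalmanson_on_def by blast
  moreover have "d y v = d v y" "d x v = d v x" "d x u = d u x" "d y u = d u y"
    using K N unfolding kalmanson_on_def by blast+
  ultimately show ?thesis by linarith
qed

text \<open>The threshold is left free because ties \<open>d u x = d v x\<close> fall outside the
  closer set but inside its complement.\<close>

lemma kalmanson_no_alternation:
  assumes K: "kalmanson_on N d" and uv: "u \<in> N" "v \<in> N"
    and N: "a \<in> N" "b \<in> N" "c \<in> N" "e \<in> N" and order: "a < b" "b < c" "c < e"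
    and inside: "t < d v a - d u a" "t < d v c - d u c"
    and outside: "d v b - d u b \<le> t" "d v e - d u e \<le> t"
  shows False
proof -
  have no: "\<not> cyclic4 u x y v \<and> \<not> cyclic4 v y x u"
    if "x \<in> {b, e}" "y \<in> {a, c}" for x y
  proof -
    have "d v x - d u x < d v y - d u y" "x \<in> N" "y \<in> N"
      using that N inside outside by auto
    then show ?thesis using kalmanson_difference_mono[OF K uv, of x y] by auto
  qed
  \<comment> \<open>By \<open>no\<close>, neither \<open>b\<close> nor \<open>e\<close> lies between
    \<open>u\<close> and \<open>a\<close> or between \<open>u\<close> and \<open>c\<close>. So
    \<open>a\<close> and \<open>c\<close> are joined through \<open>u\<close>, although
    \<open>b\<close> and \<open>e\<close> separate them on the circle.\<close>
  show False
    using no[of b a] no[of b c] no[of e a] no[of e c] order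
    unfolding cyclic4_def by (smt (verit) insertCI le_trans less_imp_le linorder_not_le)
qed

section \<open>From non-alternation to intervals\<close>

text \<open>A gap \<open>k\<close> would make \<open>Min B\<close>, \<open>k\<close>,
  \<open>Max B\<close>, \<open>n\<close> alternate; \<open>n\<close> is the fixed fourth
  point.\<close>

lemma no_alternation_imp_interval:
  fixes B :: "nat set"
  assumes "B \<noteq> {}" "B \<subseteq> {1..n}" "n \<notin> B"
    and alt: "\<And>a b c. a \<in> B \<Longrightarrow> c \<in> B \<Longrightarrow> b \<in> {1..n} - B \<Longrightarrow> a < b \<Longrightarrow> b < c \<Longrightarrow> c < n \<Longrightarrow> False"
  shows "\<exists>i j. 1 \<le> i \<and> i \<le> j \<and> j < n \<and> B = {i..j}"
proof -
  have fin: "finite B" using assms(2) finite_subset by blast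
  have mem: "Min B \<in> B" "Max B \<in> B" using fin assms(1) by auto
  then have bounds: "1 \<le> Min B" "Max B \<le> n" using assms(2) by auto
  moreover have "Max B \<noteq> n" using mem assms(3) by auto
  ultimately have lt: "Max B < n" by simp
  have "k \<in> B" if k: "Min B \<le> k" "k \<le> Max B" for k
  proof (rule ccontr)
    assume "k \<notin> B"
    then have "Min B \<noteq> k" "k \<noteq> Max B" using mem by auto
    then show False using alt[OF mem, of k] k bounds lt \<open>k \<notin> B\<close> by auto
  qed
  then have "{Min B..Max B} \<subseteq> B" by (meson atLeastAtMost_iff subsetI)
  moreover have "B \<subseteq> {Min B..Max B}" using fin by auto
  ultimately have "B = {Min B..Max B}" by (rule equalityI[rotated])
  moreover have "Min B \<le> Max B" using Min_le[OF fin mem(2)] .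
  ultimately show ?thesis using bounds(1) lt by blast
qed

text \<open>The side avoiding \<open>n\<close> cannot wrap around, so it is the one that is an
  interval.\<close>

lemma kalmanson_closer_interval:
  assumes K: "kalmanson_on {1..n} d" and uv: "u \<in> {1..n}" "v \<in> {1..n}"
    and A_def: "A = {x \<in> {1..n}. d u x < d v x}" and A: "A \<noteq> {}" "A \<noteq> {1..n}"
  shows "\<exists>i j. 1 \<le> i \<and> i \<le> j \<and> j < n \<and> (A = {i..j} \<or> {1..n} - A = {i..j})"
proof (cases "n \<in> A")
  case False
  have "\<exists>i j. 1 \<le> i \<and> i \<le> j \<and> j < n \<and> A = {i..j}"
  proof (rule no_alternation_imp_interval)
    fix a b c assume "a \<in> A" "c \<in> A" "b \<in> {1..n} - A" "a < b" "b < c" "c < n"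
    then show False
      using False uv kalmanson_no_alternation[OF K uv, of a b c n 0] unfolding A_def by simp
  qed (use A False A_def in auto)
  then show ?thesis by blast
next
  case True
  text \<open>Here \<open>n\<close> is strictly inside, so the threshold is the smaller of the two inner values
    after exchanging \<open>u\<close> and \<open>v\<close>.\<close>
  have "\<exists>i j. 1 \<le> i \<and> i \<le> j \<and> j < n \<and> {1..n} - A = {i..j}"
  proof (rule no_alternation_imp_interval)
    fix a b c
    assume *: "a \<in> {1..n} - A" "c \<in> {1..n} - A" "b \<in> {1..n} - ({1..n} - A)"
      "a < b" "b < c" "c < n"
    \<comment> \<open>After the exchange, points outside \<open>A\<close> have values at least 0,
      while \<open>b\<close> and \<open>n\<close> have negative ones. The larger of these two as
      threshold keeps the inner inequalities strict even at ties.\<close>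
    show False
      using * True uv
        kalmanson_no_alternation[OF K uv(2) uv(1), of a b c n
          "max (d u b - d v b) (d u n - d v n)"]
      unfolding A_def by auto
  qed (use A True A_def in auto)
  then show ?thesis by blast
qed

section \<open>Arc splits and the transfer to \<open>X\<close>\<close>

lemma split_dist_split_of:
  assumes "x \<in> X" "y \<in> X"
  shows "split_dist (split_of X A) x y = (if (x \<in> A) \<noteq> (y \<in> A) then 1 else 0)"
  using assms by (auto simp: split_dist_def split_of_def)

lemma split_of_compl:
  assumes "A \<subseteq> X"
  shows "split_of X (X - A) = split_of X A"
proof -
  have "X - (X - A) = A" using assms by blast
  then show ?thesis by (simp add: split_of_def insert_commute)
qed

definition arc_splits :: "'a set \<Rightarrow> (nat \<Rightarrow> 'a) \<Rightarrow> 'a set set set" where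
  "arc_splits X f = {split_of X (f ` {i..j}) | i j. 1 \<le> i \<and> i \<le> j \<and> j < card X}"

lemma arc_splits_finite_card:
  shows "finite (arc_splits X f)" and "card (arc_splits X f) \<le> card X choose 2"
proof -
  \<comment> \<open>The value \<open>j = 0\<close> contributes an empty range, so the index pairs
    number 0 + 1 + ... + (n - 1) with n = \<open>card X\<close>.\<close>
  let ?I = "SIGMA j : {..<card X}. {1..j}"
  have eq: "arc_splits X f = (\<lambda>(j, i). split_of X (f ` {i..j})) ` ?I"
    unfolding arc_splits_def by force
  show "finite (arc_splits X f)" unfolding eq by (rule finite_imageI) auto
  have "card (arc_splits X f) \<le> card ?I" unfolding eq by (rule card_image_le) auto
  also have "card ?I = \<Sum>{..<card X}" by simp
  also have "\<dots> = card X choose 2"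
    using Sum_Ico_nat[of 0 "card X"] by (simp add: lessThan_atLeast0 choose_two)
  finally show "card (arc_splits X f) \<le> card X choose 2" .
qed

lemma maximum_circular_arc_splits:
  assumes "maximum_circular X \<S>"
  obtains f where "bij_betw f {1..card X} X" "\<S> = arc_splits X f"
proof -
  obtain f where f: "bij_betw f {1..card X} X"
    and arc: "\<forall>S\<in>\<S>. \<exists>i j. 1 \<le> i \<and> i \<le> j \<and> j < card X \<and> S = split_of X (f ` {i..j})"
    using assms unfolding maximum_circular_def circular_def by blast
  have sub: "\<S> \<subseteq> arc_splits X f"
  proof
    fix S assume "S \<in> \<S>"
    with arc show "S \<in> arc_splits X f" unfolding arc_splits_def by blast
  qed
  have "card (arc_splits X f) \<le> card \<S>"
    using assms arc_splits_finite_card(2) unfolding maximum_circular_def by metis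
  then have "\<S> = arc_splits X f"
    by (rule card_seteq[OF arc_splits_finite_card(1) sub])
  with f show thesis by (rule that)
qed

text \<open>Pulled back along \<open>f\<close>, every arc split separates an interval of positions,
  and the Kalmanson inequalities survive non-negative combinations.\<close>

lemma kalmanson_on_weighted_dist:
  assumes f: "bij_betw f {1..card X} X"
    and nonneg: "\<And>S. S \<in> arc_splits X f \<Longrightarrow> 0 \<le> w S"
  shows "kalmanson_on {1..card X} (\<lambda>x y. weighted_dist (arc_splits X f) w (f x) (f y))"
  unfolding weighted_dist_def
proof (rule kalmanson_on_weighted_sum)
  fix S assume "S \<in> arc_splits X f"
  then obtain i j where ij: "1 \<le> i" "j < card X" and S: "S = split_of X (f ` {i..j})"
    unfolding arc_splits_def by blast
  have mem: "f x \<in> f ` {i..j} \<longleftrightarrow> x \<in> {i..j}" if "x \<in> {1..card X}" for x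
    using that ij by (intro inj_on_image_mem_iff[OF bij_betw_imp_inj_on[OF f]]) auto
  show "kalmanson_on {1..card X} (\<lambda>x y. split_dist S (f x) (f y))"
  proof (rule kalmanson_on_cong[OF kalmanson_on_interval[of _ i j]])
    fix x y assume xy: "x \<in> {1..card X}" "y \<in> {1..card X}"
    then have "f x \<in> X" "f y \<in> X" using f bij_betwE by blast+
    then show "split_dist S (f x) (f y) = (if (x \<in> {i..j}) \<noteq> (y \<in> {i..j}) then 1 else 0)"
      unfolding S using mem xy by (simp add: split_dist_split_of)
  qed
qed (rule nonneg)

lemma closer_set_arc_split:
  assumes f: "bij_betw f {1..card X} X"
    and nonneg: "\<And>S. S \<in> arc_splits X f \<Longrightarrow> 0 \<le> w S"
    and uv: "u \<in> X" "v \<in> X"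
    and C_def: "C = closer_set X (weighted_dist (arc_splits X f) w) u v"
    and C: "{} \<subset> C" "C \<subset> X"
  shows "split_of X C \<in> arc_splits X f"
proof -
  let ?N = "{1..card X}" and ?D = "weighted_dist (arc_splits X f) w"
  have X: "X = f ` ?N" using f by (simp add: bij_betw_def)
  obtain k l where k: "k \<in> ?N" "u = f k" and l: "l \<in> ?N" "v = f l" using uv X by blast
  define A where "A = {x \<in> ?N. ?D (f k) (f x) < ?D (f l) (f x)}"
  have fA: "f ` A = C"
    unfolding A_def C_def closer_set_def k(2) l(2) by (subst (2) X) blast
  have fA': "f ` (?N - A) = X - C"
    using fA X inj_on_image_set_diff[OF bij_betw_imp_inj_on[OF f], of ?N A]
    unfolding A_def by auto
  have ne: "A \<noteq> {}" "A \<noteq> ?N" using fA C X by auto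
  obtain i j where ij: "1 \<le> i" "i \<le> j" "j < card X" and
    "A = {i..j} \<or> ?N - A = {i..j}"
    using kalmanson_closer_interval[OF kalmanson_on_weighted_dist[OF f nonneg] k(1) l(1) A_def ne]
    by blast
  then have "C = f ` {i..j} \<or> X - C = f ` {i..j}" using fA fA' by metis
  \<comment> \<open>A split forgets which of its sides is the interval.\<close>
  then have "split_of X C = split_of X (f ` {i..j})"
    using split_of_compl[of C X] C by (metis psubset_imp_subset)
  then show ?thesis unfolding arc_splits_def using ij by blast
qed

theorem theorem4:
  fixes X :: "'a set" and \<S> :: "'a set set set"
  assumes "finite X"
    and "maximum_circular X \<S>"
  shows "orderly X \<S>"
proof -
  obtain f where f: "bij_betw f {1..card X} X" and S: "\<S> = arc_splits X f"
    using assms(2) by (rule maximum_circular_arc_splits)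
  have sys: "split_system X \<S>"
    using assms(2) unfolding maximum_circular_def circular_def by blast
  have "\<exists>w'. (\<forall>S\<in>\<S>. 0 \<le> w' S) \<and>
      (\<forall>x\<in>X. \<forall>y\<in>X. order_dist X p q (weighted_dist \<S> w) x y = weighted_dist \<S> w' x y)"
    if q: "q = p / 2" and p: "p / 2 > 0" and w: "\<forall>S\<in>\<S>. 0 \<le> w S" for p q :: real and w
  proof -
    let ?C = "closer_set X (weighted_dist \<S> w)"
    let ?g = "\<lambda>(u, v). split_of X (?C u v)"
    define P where "P = {(u, v). u \<in> X \<and> v \<in> X \<and> u \<noteq> v \<and> {} \<subset> ?C u v \<and> ?C u v \<subset> X}"
    \<comment> \<open>The new weight of \<open>S\<close> collects \<open>p / 2\<close> from each
      ordered pair whose closer set induces \<open>S\<close>; it is 0 if there is none.\<close>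
    define w' where "w' S = (\<Sum>z\<in>{z \<in> P. ?g z = S}. p / 2)" for S
    have "P \<subseteq> X \<times> X" unfolding P_def by auto
    then have finP: "finite P" using assms(1) finite_subset by blast
    have finS: "finite \<S>" unfolding S by (rule arc_splits_finite_card)
    have img: "?g ` P \<subseteq> \<S>"
    proof (clarify)
      fix u v assume "(u, v) \<in> P"
      then have "u \<in> X" "v \<in> X" "{} \<subset> ?C u v" "?C u v \<subset> X" unfolding P_def by simp_all
      with w show "split_of X (?C u v) \<in> \<S>"
        unfolding S by (intro closer_set_arc_split[OF f _ _ _ refl]) simp_all
    qed
    have "order_dist X p q (weighted_dist \<S> w) x y = weighted_dist \<S> w' x y" for x y
    proof -
      \<comment> \<open>The factor \<open>q - p / 2\<close> is 0, so the equidistant sum vanishes;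
        the rest is then grouped by induced split.\<close>
      have "order_dist X p q (weighted_dist \<S> w) x y = (\<Sum>z\<in>P. p / 2 * split_dist (?g z) x y)"
        unfolding order_dist_def P_def q by (simp add: case_prod_unfold)
      also have "\<dots> = (\<Sum>S\<in>\<S>. \<Sum>z\<in>{z \<in> P. ?g z = S}. p / 2 * split_dist (?g z) x y)"
        using finP finS img by (rule sum.group[symmetric])
      also have "\<dots> = weighted_dist \<S> w' x y"
        unfolding weighted_dist_def w'_def sum_distrib_right
        by (intro sum.cong) auto
      finally show ?thesis .
    qed
    moreover have "0 \<le> w' S" for S unfolding w'_def using p by (intro sum_nonneg) simp
    ultimately show ?thesis by blast
  qed
  then show ?thesis unfolding orderly_def using sys by blast
qed

end
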